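(* Let $G$ be a graph with $\delta(G) \ge (1-d)v(G)$ where $d=\frac{7 - \sqrt{21}}{14}$. Then $w_G(O)\ge 0$ for every ordered triangle $O\in \mathcal{OK}_3(G)$.
   Context: $\mathcal{K}_\ell(G)$ is the set of cliques on $\ell$ vertices of $G$; for a vertex set $S$, $\mathcal{K}_\ell(G,S)$ is the set of those containing $S$. An ordered $r$-clique is a tuple $(v_1,\ldots,v_r)$ of distinct vertices spanning a clique; $\mathcal{OK}_r(G)$ is the set of these. For $O=(x_1,x_2,x_3)\in\mathcal{OK}_3(G)$, $\mathcal{OK}_5(G,O)$ is the set of $(v_1,\ldots,v_5)\in\mathcal{OK}_5(G)$ such that $x_1,x_2,x_3$ appears as a (not necessarily consecutive) subsequence of $v_1,\ldots,v_5$. For $(v_1,\ldots,v_r)\in\mathcal{OK}_r(G)$, $r\in\{2,3,4\}$, define $W(v_1,\ldots,v_r)=\prod_{i=2}^r \frac{1}{|\mathcal{K}_{i+1}(G,\{v_1,\ldots,v_i\})|}$. For $K=(v_1,\ldots,v_5)\in\mathcal{OK}_5(G,O)$ let $\psi_K(O)=+\frac13$ if $|\{x_1,x_2,x_3\}\cap\{v_1,v_2\}|\in\{0,2\}$ and $\psi_K(O)=-\frac16$ if $|\{x_1,x_2,x_3\}\cap\{v_1,v_2\}|=1$. Define $w_G(O)=\frac12\sum_{K=(v_1,\ldots,v_5)\in\mathcal{OK}_5(G,O)} W(v_1,\ldots,v_4)\,\psi_K(O)$. *)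

theory Defs
  imports Complex_Main "HOL-Library.Sublist" "Graph_Theory.Pair_Digraph"
begin

text \<open>
  A finite simple graph is a \<^locale>\<open>pair_graph\<close>: a finite symmetric loop-free digraph, in which
  an undirected edge \<open>uv\<close> is represented by the two arcs \<open>(u, v)\<close> and \<open>(v, u)\<close>. Hence the degree of
  a vertex is its out-degree.
\<close>

definition min_degree :: "'a pair_pre_digraph \<Rightarrow> nat" where
  "min_degree G = Min (out_degree (with_proj G) ` pverts G)"

definition is_clique :: "'a pair_pre_digraph \<Rightarrow> 'a set \<Rightarrow> bool" where
  "is_clique G S \<longleftrightarrow> S \<subseteq> pverts G \<and> (\<forall>u\<in>S. \<forall>v\<in>S. u \<noteq> v \<longrightarrow> (u, v) \<in> parcs G)"

definition cliques :: "nat \<Rightarrow> 'a pair_pre_digraph \<Rightarrow> 'a set set" where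
  "cliques l G = {S. is_clique G S \<and> card S = l}"

definition cliques_containing :: "nat \<Rightarrow> 'a pair_pre_digraph \<Rightarrow> 'a set \<Rightarrow> 'a set set" where
  "cliques_containing l G S = {K \<in> cliques l G. S \<subseteq> K}"

text \<open>The tuple \<open>(v\<^sub>1, \<dots>, v\<^sub>r)\<close> is the list \<open>[v\<^sub>1, \<dots>, v\<^sub>r]\<close>.\<close>

definition ordered_cliques :: "nat \<Rightarrow> 'a pair_pre_digraph \<Rightarrow> 'a list set" where
  "ordered_cliques r G = {vs. length vs = r \<and> distinct vs \<and> is_clique G (set vs)}"

definition ordered_5cliques_over :: "'a pair_pre_digraph \<Rightarrow> 'a list \<Rightarrow> 'a list set" where
  "ordered_5cliques_over G xs = {vs \<in> ordered_cliques 5 G. subseq xs vs}"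

definition W :: "'a pair_pre_digraph \<Rightarrow> 'a list \<Rightarrow> real" where
  "W G vs = (\<Prod>i = 2..length vs. 1 / real (card (cliques_containing (i + 1) G (set (take i vs)))))"

text \<open>The cardinality below is at most 2, so the \<open>else\<close> branch is the case of cardinality 1.\<close>

definition \<psi> :: "'a list \<Rightarrow> 'a list \<Rightarrow> real" where
  "\<psi> vs xs = (if card (set xs \<inter> set (take 2 vs)) \<in> {0, 2} then 1 / 3 else - 1 / 6)"

definition triangle_weight :: "'a pair_pre_digraph \<Rightarrow> 'a list \<Rightarrow> real" where
  "triangle_weight G xs = 1 / 2 * (\<Sum>vs \<in> ordered_5cliques_over G xs. W G (take 4 vs) * \<psi> vs xs)"

end

theory Submission
  imports Defs
begin

text \<open>
  Group the ordered 5-cliques over \<open>(x1, x2, x3)\<close> by the pair \<open>(y, z)\<close> of their other two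
  vertices, taken in order of appearance. The ten interleavings of \<open>(x1, x2, x3)\<close> and \<open>(y, z)\<close>
  already have nonnegative total weight, for every \<open>(y, z)\<close> separately. Indeed \<open>W\<close> is a product of
  reciprocals of common neighbourhood sizes; adding a vertex to a set costs at most \<open>d * n\<close> common
  neighbours, and common neighbourhood sizes are supermodular. The total weight is monotone
  in most of the sizes, so these may be pushed to their extreme values, and after scaling
  a polynomial inequality in three variables remains. It is tight exactly when
  \<open>1 - 7 * d + 7 * d\<^sup>2 = 0\<close>, which is where the value of \<open>d\<close> comes from.
\<close>

section \<open>Polynomial and rational inequalities for the worst case\<close>

text \<open>\<open>D\<close> is small enough for crude bounds: on the unit square the constant
  coefficient is at least 3 and the others are at least -6, -6 and -20.\<close>

lemma poly_remainder_nonneg: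
  fixes D x y :: real
  assumes D: "0 \<le> D" "D \<le> 27 / 100" and x: "0 \<le> x" "x \<le> 1" and y: "0 \<le> y" "y \<le> 1"
  shows "0 \<le> (10 - 3*x - 4*y) + D * (14 - 13*x - 20*y + 13*x*y + 2*x^2)
    + D^2 * (4 - 10*x + 6*x^2 - 14*y + 18*x*y - 8*x^2*y + 10*y^2 - 5*x*y^2)
    + D^3 * (- x + 2*x^2 - x^3 - 2*y + 5*x*y - 4*x^2*y + x^3*y
      + 4*y^2 - 5*x*y^2 + 2*x^2*y^2 - 2*y^3 + x*y^3)"
    (is "0 \<le> ?c0 + D * ?c1 + D^2 * ?c2 + D^3 * ?c3")
proof -
  have m: "0 \<le> x^i * y^j \<and> x^i * y^j \<le> 1" for i j :: nat
    using x y by (auto intro!: mult_nonneg_nonneg mult_le_one power_le_one)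
  have ms: "0 \<le> x^2" "x^2 \<le> 1" "x^3 \<le> 1" "0 \<le> y^2" "y^2 \<le> 1" "y^3 \<le> 1" "0 \<le> x * y" "x * y \<le> 1"
    "x^2 * y \<le> 1" "0 \<le> x^3 * y" "x * y^2 \<le> 1" "0 \<le> x^2 * y^2" "0 \<le> x * y^3"
    using m[of 2 0] m[of 3 0] m[of 0 2] m[of 0 3] m[of 1 1] m[of 2 1] m[of 3 1] m[of 1 2] m[of 2 2]
      m[of 1 3]
    by simp_all
  have "0 \<le> (1 - y) * (20 - 13 * x)" using x y by (intro mult_nonneg_nonneg) auto
  then have "-6 \<le> 14 - 13*x - 20*y + 13*x*y" by (simp add: algebra_simps)
  then have "-6 \<le> ?c1" using zero_le_power2[of x] by linarith
  moreover have "0 \<le> (x * y) * (18 - 8 * x - 5 * y)"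
    using x y by (intro mult_nonneg_nonneg) auto
  \<comment> \<open>The points \<open>5/6\<close> and \<open>7/10\<close> complete the squares in
    \<open>6*x^2 - 10*x\<close> and \<open>10*y^2 - 14*y\<close>.\<close>
  then have "-6 \<le> ?c2"
    using zero_le_power2[of "x - 5/6"] zero_le_power2[of "y - 7/10"]
    by (simp add: power2_eq_square algebra_simps)
  moreover have "-20 \<le> ?c3" using ms x y by linarith
  ultimately have "D * (-6) \<le> D * ?c1" "D^2 * (-6) \<le> D^2 * ?c2" "D^3 * (-20) \<le> D^3 * ?c3"
    using D(1) by (simp_all only: mult_left_mono zero_le_power)
  moreover have "D^2 \<le> (27/100)^2" "D^3 \<le> (27/100)^3" using D by (auto intro!: power_mono)
  then have "D^2 \<le> 729/10000" "D^3 \<le> 19683/1000000" by (simp_all add: power_divide)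
  ultimately show ?thesis using D x y by linarith
qed

text \<open>Here \<open>p\<close> is scaled to 1. The expression splits into three nonnegative
  terms: the slack in the bound on \<open>D\<close> times a positive factor, a multiple of
  \<open>t^2\<close>, and \<open>s * D * R\<close> with \<open>R\<close> the polynomial above at
  \<open>x = s / D\<close>, \<open>y = t / D\<close>.\<close>

lemma normalized_ineq:
  fixes s t D :: real
  assumes s: "0 \<le> s" "s \<le> D" and t: "0 \<le> t" "t \<le> D" and D: "3 * D + 3 * D^2 \<le> 1"
  defines "b \<equiv> 1 - s" and "c \<equiv> 1 - t" and "e \<equiv> 1 - s - t" and "a \<equiv> 1 - s + D" and "q \<equiv> 1 - t + D"
  shows "0 \<le> b * c * e * q - (D - s) * a * (e + b) * c * q - (D - t) * a^2 * b^2"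
proof -
  have "0 \<le> D" using s by simp
  \<comment> \<open>The bound lies just above (sqrt 21 - 3) / 6, the positive root of
    \<open>3 * D + 3 * D^2 = 1\<close>.\<close>
  have "D \<le> 27 / 100"
  proof (rule ccontr)
    assume "\<not> ?thesis"
    then have "(27/100)^2 < D^2" by (intro power_strict_mono) auto
    with \<open>\<not> ?thesis\<close> D show False by (simp add: power2_eq_square)
  qed
  show ?thesis
  proof (cases "D = 0")
    case True
    then show ?thesis using s t by (simp add: b_def c_def e_def a_def q_def)
  next
    case False
    with \<open>0 \<le> D\<close> have "0 < D" by simp
    define x y where "x = s / D" and "y = t / D"
    have sx: "s = x * D" and ty: "t = y * D" using \<open>0 < D\<close> by (simp_all add: x_def y_def)
    have x: "0 \<le> x" "x \<le> 1" and y: "0 \<le> y" "y \<le> 1"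
      using s t \<open>0 < D\<close> by (simp_all add: x_def y_def)
    define R where "R = (10 - 3*x - 4*y) + D * (14 - 13*x - 20*y + 13*x*y + 2*x^2)
    + D^2 * (4 - 10*x + 6*x^2 - 14*y + 18*x*y - 8*x^2*y + 10*y^2 - 5*x*y^2)
    + D^3 * (- x + 2*x^2 - x^3 - 2*y + 5*x*y - 4*x^2*y + x^3*y
      + 4*y^2 - 5*x*y^2 + 2*x^2*y^2 - 2*y^3 + x*y^3)"
    have "0 \<le> R" unfolding R_def
      by (rule poly_remainder_nonneg) (use \<open>0 \<le> D\<close> \<open>D \<le> 27/100\<close> x y in auto)
    \<comment> \<open>Equality holds at \<open>s = t = 0\<close>, \<open>3 * D + 3 * D\<^sup>2 = 1\<close>, where even the derivative in \<open>t\<close> vanishes.\<close>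
    have eq: "b * c * e * q - (D - s) * a * (e + b) * c * q - (D - t) * a^2 * b^2
      = (1 - 3 * D - 3 * D^2) * ((1 + D) - t * (2 + D))
        + t^2 * ((3 - 3*D - 5*D^2 - D^3) - (1 - D - D^2) * t) + s * D * R"
      unfolding b_def c_def e_def a_def q_def R_def sx ty by algebra
    have D2: "D^2 \<le> (27/100)^2" "D^3 \<le> (27/100)^3"
      using \<open>0 \<le> D\<close> \<open>D \<le> 27/100\<close> by (auto intro!: power_mono)
    have "t * (2 + D) \<le> (27/100) * 3"
      using t \<open>0 \<le> D\<close> \<open>D \<le> 27/100\<close> by (intro mult_mono) auto
    then have "0 \<le> (1 - 3 * D - 3 * D^2) * ((1 + D) - t * (2 + D))"
      using D \<open>0 \<le> D\<close> by (intro mult_nonneg_nonneg) auto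
    moreover have "(1 - D - D^2) * t \<le> 1 * (27/100)"
      using t \<open>0 \<le> D\<close> \<open>D \<le> 27/100\<close> zero_le_power2[of D] by (intro mult_mono) linarith+
    then have "0 \<le> t^2 * ((3 - 3*D - 5*D^2 - D^3) - (1 - D - D^2) * t)"
      using D2 \<open>D \<le> 27/100\<close> by (intro mult_nonneg_nonneg) (auto simp: power_divide)
    moreover have "0 \<le> s * D * R" using s \<open>0 \<le> D\<close> \<open>0 \<le> R\<close> by simp
    ultimately show ?thesis unfolding eq by linarith
  qed
qed

text \<open>The expression is homogeneous of degree 5, so dividing every size by \<open>p\<close>
  gives the normalized form.\<close>

lemma cleared_ineq:
  fixes b c p M :: real
  assumes "0 < p" and b: "b \<le> p" "p \<le> b + M" and c: "c \<le> p" "p \<le> c + M"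
    and M: "3 * M^2 + 3 * M * p \<le> p^2"
  defines "e \<equiv> b + c - p" and "a \<equiv> b + M" and "q \<equiv> c + M"
  shows "0 \<le> p * b * c * e * q - (a - p) * a * (e + b) * c * q - (q - p) * a^2 * b^2"
proof -
  define s t D where "s = (p - b) / p" and "t = (p - c) / p" and "D = M / p"
  have eqs: "b = p * (1 - s)" "c = p * (1 - t)" "M = p * D"
    using \<open>0 < p\<close> by (simp_all add: s_def t_def D_def field_simps)
  have "3 * D + 3 * D^2 = (3 * M^2 + 3 * M * p) / p^2"
    using \<open>0 < p\<close> by (simp add: D_def field_simps power2_eq_square)
  also have "\<dots> \<le> 1" using M \<open>0 < p\<close> by simp
  finally have "3 * D + 3 * D^2 \<le> 1" .
  moreover have "0 \<le> s" "s \<le> D" "0 \<le> t" "t \<le> D"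
    using b c \<open>0 < p\<close> by (auto simp: s_def t_def D_def divide_right_mono)
  ultimately have "0 \<le> (1 - s) * (1 - t) * (1 - s - t) * (1 - t + D)
      - (D - s) * (1 - s + D) * ((1 - s - t) + (1 - s)) * (1 - t) * (1 - t + D)
      - (D - t) * (1 - s + D)^2 * (1 - s)^2" (is "0 \<le> ?Q")
    by (intro normalized_ineq)
  then have "0 \<le> p^5 * ?Q" using \<open>0 < p\<close> by simp
  also have "p^5 * ?Q = p * b * c * e * q - (a - p) * a * (e + b) * c * q - (q - p) * a^2 * b^2"
    unfolding e_def a_def q_def eqs by algebra
  finally show ?thesis .
qed

text \<open>Clearing the positive common denominator \<open>a^2 * b^2 * c * e * q * p\<close> leaves
  the preceding polynomial.\<close>

lemma worst_case_ineq:
  fixes b c p M :: real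
  assumes "0 < p" "0 \<le> M" and b: "b \<le> p" "p \<le> b + M" and c: "c \<le> p" "p \<le> c + M"
    and M: "3 * M^2 + 3 * M * p \<le> p^2"
    and pos: "0 < b" "0 < c" "0 < b + c - p"
  defines "e \<equiv> b + c - p" and "a \<equiv> b + M" and "q \<equiv> c + M"
  shows "0 \<le> (1 / a^2 + (1 / a - 1 / p) / b) / b
    + ((1 / a - 1 / p) / b + (1 / q - 1 / p) / c) / e"
proof -
  have nz: "a > 0" "q > 0" "e > 0" using assms by auto
  have "(1 / a^2 + (1 / a - 1 / p) / b) / b
      + ((1 / a - 1 / p) / b + (1 / q - 1 / p) / c) / e
    = (p * b * c * e * q - (a - p) * a * (e + b) * c * q - (q - p) * a^2 * b^2)
      / (a^2 * b^2 * c * e * q * p)"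
    using nz pos \<open>0 < p\<close> by (simp add: divide_simps; algebra)
  moreover have "0 \<le> p * b * c * e * q - (a - p) * a * (e + b) * c * q - (q - p) * a^2 * b^2"
    unfolding e_def a_def q_def using assms by (intro cleared_ineq) auto
  ultimately show ?thesis using nz pos \<open>0 < p\<close> by simp
qed

text \<open>
  The variables stand for common neighbourhood sizes: \<open>a\<close>, \<open>A\<close>, \<open>f\<close> belong to \<open>{x1, x2}\<close>,
  \<open>{x1, x2, x3}\<close>, \<open>{x1, x2, x3, y}\<close>, and \<open>b\<close>, \<open>p\<close>, \<open>c\<close>, \<open>q\<close>, \<open>e\<close> to \<open>{x1, x2, y}\<close>, \<open>{x1, y}\<close>,
  \<open>{x1, y, z}\<close>, \<open>{y, z}\<close>, \<open>{x1, x2, y, z}\<close>; \<open>M\<close> bounds the number of non-neighbours of a vertex.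
  The worst case is \<open>A = a = b + M\<close>, \<open>f = b\<close>, \<open>q = c + M\<close>, \<open>e = b + c - p\<close>.
\<close>

lemma interleaving_weights_nonneg:
  fixes a A f b p c q e M :: real
  assumes "0 < A" "A \<le> a" "0 < f" "f \<le> b" "b \<le> a" "a \<le> b + M" and b: "b \<le> p" "p \<le> b + M"
    and c: "c \<le> p" "p \<le> c + M" and "0 < q" "q \<le> c + M" and "b + c - p \<le> e"
    and M: "3 * M^2 + 3 * M * p \<le> p^2" and "0 \<le> M" "0 < c" "0 < b + c - p"
  shows "0 \<le> 1 / (a * A * f) + 1 / (a * b * f) + 1 / (a * b * e) + 1 / (q * c * e)
    - 1 / (p * b * f) - 1 / (p * b * e) - 1 / (p * c * e)"
proof -
  have pos: "0 < a" "0 < b" "0 < p" "0 < e" using assms by linarith+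
  \<comment> \<open>Grouped by the last factor \<open>f\<close> or \<open>e\<close>, the seven terms
    are \<open>(1 / (a * A) + u) / f + (u + v) / e\<close>. The primed versions take
    \<open>a\<close> and \<open>q\<close> at their largest.\<close>
  define u where "u = (1 / a - 1 / p) / b"
  define u' where "u' = (1 / (b + M) - 1 / p) / b"
  define v where "v = (1 / q - 1 / p) / c"
  define v' where "v' = (1 / (c + M) - 1 / p) / c"
  have inv: "1 / (b + M) \<le> 1 / a" using assms pos by (intro divide_left_mono) auto
  have "u' \<le> u" unfolding u_def u'_def
    using pos inv by (intro divide_right_mono) auto
  moreover have "v' \<le> v" unfolding v_def v'_def
    using assms pos by (intro divide_right_mono diff_right_mono divide_left_mono) auto
  ultimately have uv: "u' + v' \<le> u + v" by simp
  \<comment> \<open>With this sign, shrinking \<open>e\<close> to \<open>b + c - p\<close> only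
    lowers the quotient.\<close>
  have "u' \<le> 0" "v' \<le> 0" unfolding u'_def v'_def
    using assms pos by (auto simp: divide_le_0_iff intro!: divide_left_mono)
  then have "u' + v' \<le> 0" by simp
  then have "(u' + v') / (b + c - p) \<le> (u' + v') / e"
    using assms pos by (intro divide_left_mono_neg) auto
  also have "\<dots> \<le> (u + v) / e" using uv pos by (intro divide_right_mono) auto
  finally have 1: "(u' + v') / (b + c - p) \<le> (u + v) / e" .
  have "(1 / (b + M))^2 \<le> (1 / a)^2" using inv assms pos by (intro power_mono) auto
  also have "\<dots> \<le> 1 / (a * A)" using assms pos by (simp add: power2_eq_square divide_left_mono)
  finally have 2: "1 / (b + M)^2 + u' \<le> 1 / (a * A) + u"
    using \<open>u' \<le> u\<close> by (simp add: power_one_over)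
  have main: "0 \<le> (1 / (b + M)^2 + u') / b + (u' + v') / (b + c - p)"
    unfolding u'_def v'_def using assms pos by (intro worst_case_ineq) auto
  \<comment> \<open>Raising \<open>f\<close> to \<open>b\<close> lowers the first summand only if
    its numerator is nonnegative. The worst case itself yields this, since its second summand is
    nonpositive.\<close>
  have "(u' + v') / (b + c - p) \<le> 0"
    using \<open>u' + v' \<le> 0\<close> \<open>0 < b + c - p\<close> by (simp add: divide_nonpos_pos)
  with main have "0 \<le> (1 / (b + M)^2 + u') / b" by linarith
  then have nn: "0 \<le> 1 / (b + M)^2 + u'" using pos by (simp add: zero_le_divide_iff)
  have "(1 / (b + M)^2 + u') / b \<le> (1 / (b + M)^2 + u') / f"
    using nn assms pos by (intro divide_left_mono) auto
  also have "\<dots> \<le> (1 / (a * A) + u) / f" using 2 assms by (intro divide_right_mono) auto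
  finally have "0 \<le> (1 / (a * A) + u) / f + (u + v) / e" using main 1 by linarith
  also have "\<dots> = 1 / (a * A * f) + 1 / (a * b * f) + 1 / (a * b * e) + 1 / (q * c * e)
    - 1 / (p * b * f) - 1 / (p * b * e) - 1 / (p * c * e)"
    by (simp add: u_def v_def diff_divide_distrib add_divide_distrib mult.assoc)
  finally show ?thesis .
qed

section \<open>Common neighbourhoods and clique counts\<close>

definition common_nbrs :: "'a pair_pre_digraph \<Rightarrow> 'a set \<Rightarrow> 'a set" where
  "common_nbrs G S = {w \<in> pverts G. \<forall>u\<in>S. (u, w) \<in> parcs G}"

context pair_graph
begin

lemma finite_common_nbrs [simp]: "finite (common_nbrs G S)"
  by (auto simp: common_nbrs_def pair_finite_verts)

lemma common_nbrs_antimono: "S \<subseteq> T \<Longrightarrow> common_nbrs G T \<subseteq> common_nbrs G S"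
  by (auto simp: common_nbrs_def)

lemma common_nbrs_disjoint: "w \<in> common_nbrs G S \<Longrightarrow> w \<notin> S"
  using no_loops'[of w w] by (auto simp: common_nbrs_def)

lemma is_clique_insert_iff:
  "w \<notin> S \<Longrightarrow> is_clique G (insert w S) \<longleftrightarrow> is_clique G S \<and> w \<in> common_nbrs G S"
  using arcs_symmetric by (auto simp: is_clique_def common_nbrs_def)

text \<open>This turns the factors of \<open>W\<close> into common neighbourhood sizes: a clique
  with one vertex more than \<open>S\<close> is determined by that vertex.\<close>

lemma card_cliques_containing:
  assumes "is_clique G S"
  shows "card (cliques_containing (card S + 1) G S) = card (common_nbrs G S)"
proof -
  have "finite S"
    using assms finite_subset[OF _ pair_finite_verts] by (simp add: is_clique_def)
  have "bij_betw (\<lambda>w. insert w S) (common_nbrs G S) (cliques_containing (card S + 1) G S)"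
    unfolding bij_betw_def
  proof
    show "inj_on (\<lambda>w. insert w S) (common_nbrs G S)"
      by (auto simp: inj_on_def dest: common_nbrs_disjoint)
    show "(\<lambda>w. insert w S) ` common_nbrs G S = cliques_containing (card S + 1) G S"
    proof (intro equalityI subsetI)
      fix K assume "K \<in> (\<lambda>w. insert w S) ` common_nbrs G S"
      then show "K \<in> cliques_containing (card S + 1) G S"
        using \<open>finite S\<close> assms common_nbrs_disjoint
        by (auto simp: cliques_containing_def cliques_def is_clique_insert_iff)
    next
      fix K assume "K \<in> cliques_containing (card S + 1) G S"
      then have K: "is_clique G K" "card K = card S + 1" "S \<subseteq> K"
        by (auto simp: cliques_containing_def cliques_def)
      then have "card (K - S) = 1" using \<open>finite S\<close> by (simp add: card_Diff_subset)
      then obtain w where "K - S = {w}" by (auto simp: card_1_singleton_iff)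
      then have w: "K = insert w S" "w \<notin> S" using K by auto
      with K(1) is_clique_insert_iff[of w S] show "K \<in> (\<lambda>w. insert w S) ` common_nbrs G S"
        by auto
    qed
  qed
  then show ?thesis by (simp add: bij_betw_same_card)
qed

lemma W_four:
  assumes "is_clique G K" "{u1, u2, u3, u4} \<subseteq> K" "distinct [u1, u2, u3, u4]"
  shows "W G [u1, u2, u3, u4] = 1 / (real (card (common_nbrs G {u1, u2}))
    * real (card (common_nbrs G {u1, u2, u3})) * real (card (common_nbrs G {u1, u2, u3, u4})))"
proof -
  have cl: "is_clique G {u1, u2}" "is_clique G {u1, u2, u3}" "is_clique G {u1, u2, u3, u4}"
    using assms(1,2) by (auto simp: is_clique_def)
  have card: "card {u1, u2} + 1 = 3" "card {u1, u2, u3} + 1 = 4" "card {u1, u2, u3, u4} + 1 = 5"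
    using assms(3) by auto
  have "{2..length [u1, u2, u3, u4]} = {2, 3, 4}" by auto
  then show ?thesis
    unfolding W_def using cl[THEN card_cliques_containing] unfolding card by (simp add: mult.assoc)
qed

lemma out_degree_eq_card_common_nbrs: "out_degree (with_proj G) v = card (common_nbrs G {v})"
proof -
  have "out_arcs (with_proj G) v = Pair v ` common_nbrs G {v}"
    by (auto simp: out_arcs_def common_nbrs_def dest: in_arcsD2)
  then show ?thesis by (simp add: out_degree_def card_image inj_on_def)
qed

lemma card_nonnbrs_le:
  assumes "v \<in> pverts G"
  shows "card (pverts G - common_nbrs G {v}) \<le> card (pverts G) - min_degree G"
proof -
  have "min_degree G \<le> card (common_nbrs G {v})"
    using assms pair_finite_verts
    by (auto simp: min_degree_def out_degree_eq_card_common_nbrs[symmetric] intro: Min_le)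
  moreover have "common_nbrs G {v} \<subseteq> pverts G" by (auto simp: common_nbrs_def)
  ultimately show ?thesis by (simp add: card_Diff_subset)
qed

text \<open>Only non-neighbours of \<open>v\<close> are lost.\<close>

lemma card_common_nbrs_le_insert:
  assumes "v \<in> pverts G"
  shows "card (common_nbrs G S) \<le> card (common_nbrs G (insert v S)) + (card (pverts G) - min_degree G)"
proof -
  have "common_nbrs G S \<subseteq> common_nbrs G (insert v S) \<union> (pverts G - common_nbrs G {v})"
    by (auto simp: common_nbrs_def)
  then have "card (common_nbrs G S) \<le> card (common_nbrs G (insert v S) \<union> (pverts G - common_nbrs G {v}))"
    by (intro card_mono) (auto simp: pair_finite_verts)
  also have "\<dots> \<le> card (common_nbrs G (insert v S)) + card (pverts G - common_nbrs G {v})"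
    by (rule card_Un_le)
  finally show ?thesis using card_nonnbrs_le[OF assms] by linarith
qed

text \<open>Inclusion-exclusion for two subsets of \<open>common_nbrs G S\<close>.\<close>

lemma card_common_nbrs_supermodular:
  "card (common_nbrs G (insert v S)) + card (common_nbrs G (insert w S))
    \<le> card (common_nbrs G (insert v (insert w S))) + card (common_nbrs G S)"
proof -
  let ?N = "common_nbrs G"
  have "?N (insert v (insert w S)) = ?N (insert v S) \<inter> ?N (insert w S)"
    by (auto simp: common_nbrs_def)
  moreover have "card (?N (insert v S) \<union> ?N (insert w S)) \<le> card (?N S)"
    by (intro card_mono) (auto simp: common_nbrs_def pair_finite_verts)
  ultimately show ?thesis using card_Un_Int[of "?N (insert v S)" "?N (insert w S)"] by simp
qed

end

section \<open>Grouping ordered 5-cliques into interleavings\<close>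

lemma filter_subseq_distinct:
  assumes "subseq xs vs" "distinct vs"
  shows "filter (\<lambda>v. v \<in> set xs) vs = xs"
  using assms by (auto simp: subseq_conv_nths filter_in_nths)

text \<open>Being an ordered clique depends only on the vertex set and the length, so every
  interleaving of \<open>xs\<close> and \<open>ys\<close> qualifies. Conversely, splitting a list by
  membership in \<open>xs\<close> exhibits it as an interleaving.\<close>

lemma ordered_5cliques_over_fiber:
  assumes "vs \<in> ordered_5cliques_over G xs"
  defines "ys \<equiv> filter (\<lambda>v. v \<notin> set xs) vs"
  shows "{us \<in> ordered_5cliques_over G xs. filter (\<lambda>v. v \<notin> set xs) us = ys} = shuffles xs ys"
proof (intro equalityI subsetI)
  have mem: "us \<in> shuffles xs (filter (\<lambda>v. v \<notin> set xs) us)" if "us \<in> ordered_5cliques_over G xs" for us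
    using partition_in_shuffles[of us "\<lambda>v. v \<in> set xs"] filter_subseq_distinct[of xs us] that
    by (simp add: ordered_5cliques_over_def ordered_cliques_def)
  {
    fix us assume "us \<in> {us \<in> ordered_5cliques_over G xs. filter (\<lambda>v. v \<notin> set xs) us = ys}"
    then show "us \<in> shuffles xs ys" using mem by auto
  next
    fix us assume us: "us \<in> shuffles xs ys"
    have disj: "set xs \<inter> set ys = {}" by (auto simp: ys_def)
    have vs: "vs \<in> shuffles xs ys" "distinct vs" "length vs = 5" "is_clique G (set vs)"
      using assms(1) mem by (auto simp: ys_def ordered_5cliques_over_def ordered_cliques_def)
    have eq: "set us = set vs" "length us = length vs"
      using us vs(1) by (auto simp: set_shuffles length_shuffles)
    have "distinct us" using eq vs(2) by (metis distinct_card card_distinct)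
    moreover have "subseq xs us"
      using filter_shuffles_disjoint1(1)[OF disj us] subseq_filter_left by metis
    ultimately show "us \<in> {us \<in> ordered_5cliques_over G xs. filter (\<lambda>v. v \<notin> set xs) us = ys}"
      using eq vs filter_shuffles_disjoint1(2)[OF disj us]
      by (simp add: ordered_5cliques_over_def ordered_cliques_def)
  }
qed

lemma sum_shuffles_3_2:
  fixes g :: "'a list \<Rightarrow> real"
  assumes "distinct [x1, x2, x3, y, z]"
  shows "sum g (shuffles [x1, x2, x3] [y, z]) =
    g [x1, x2, x3, y, z] + g [x1, x2, y, x3, z] + g [x1, x2, y, z, x3] + g [y, z, x1, x2, x3]
    + g [x1, y, x2, x3, z] + g [y, x1, x2, x3, z] + g [x1, y, x2, z, x3] + g [y, x1, x2, z, x3]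
    + g [x1, y, z, x2, x3] + g [y, x1, z, x2, x3]"
proof -
  have "shuffles [x1, x2, x3] [y, z] =
    {[x1, x2, x3, y, z], [x1, x2, y, x3, z], [x1, x2, y, z, x3], [y, z, x1, x2, x3],
     [x1, y, x2, x3, z], [y, x1, x2, x3, z], [x1, y, x2, z, x3], [y, x1, x2, z, x3],
     [x1, y, z, x2, x3], [y, x1, z, x2, x3]}"
    by (simp add: insert_commute)
  then show ?thesis using assms by simp
qed

lemma \<psi>_Cons_Cons:
  assumes "u \<noteq> v"
  shows "\<psi> (u # v # us) xs = (if u \<in> set xs \<longleftrightarrow> v \<in> set xs then 1 / 3 else - 1 / 6)"
  using assms by (cases "u \<in> set xs"; cases "v \<in> set xs") (simp_all add: \<psi>_def numeral_2_eq_2)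

text \<open>\<open>W\<close> sees only the sets of the first two, three and four vertices. Hence the
  six interleavings that start with \<open>x1\<close> and \<open>y\<close> in either order pair up,
  each pair contributing factor -1/3; the other four carry 1/3.\<close>

lemma (in pair_graph) shuffles_weight_sum:
  assumes "distinct [x1, x2, x3, y, z]" "is_clique G {x1, x2, x3, y, z}"
  defines "k \<equiv> \<lambda>S. real (card (common_nbrs G S))"
  shows "(\<Sum>vs\<in>shuffles [x1, x2, x3] [y, z]. W G (take 4 vs) * \<psi> vs [x1, x2, x3]) =
    (1 / (k {x1, x2} * k {x1, x2, x3} * k {x1, x2, x3, y})
    + 1 / (k {x1, x2} * k {x1, x2, y} * k {x1, x2, x3, y})
    + 1 / (k {x1, x2} * k {x1, x2, y} * k {x1, x2, y, z})
    + 1 / (k {y, z} * k {x1, y, z} * k {x1, x2, y, z})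
    - 1 / (k {x1, y} * k {x1, x2, y} * k {x1, x2, x3, y})
    - 1 / (k {x1, y} * k {x1, x2, y} * k {x1, x2, y, z})
    - 1 / (k {x1, y} * k {x1, y, z} * k {x1, x2, y, z})) / 3"
proof -
  have take4: "take 4 [u1, u2, u3, u4, u5] = [u1, u2, u3, u4]" for u1 u2 u3 u4 u5 :: 'a by simp
  have ne: "x1 \<noteq> x2" "x1 \<noteq> x3" "x1 \<noteq> y" "x1 \<noteq> z" "x2 \<noteq> x3" "x2 \<noteq> y" "x2 \<noteq> z" "x3 \<noteq> y" "x3 \<noteq> z" "y \<noteq> z"
    using assms(1) by auto
  have W: "W G [u1, u2, u3, u4] = 1 / (k {u1, u2} * k {u1, u2, u3} * k {u1, u2, u3, u4})"
    if "{u1, u2, u3, u4} \<subseteq> {x1, x2, x3, y, z}" "distinct [u1, u2, u3, u4]" for u1 u2 u3 u4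
    unfolding k_def by (rule W_four[OF assms(2) that])
  show ?thesis
    unfolding sum_shuffles_3_2[OF assms(1)] take4
    using ne ne[symmetric] by (simp add: W \<psi>_Cons_Cons insert_commute)
qed

section \<open>The degree condition and the conclusion\<close>

lemma (in pair_graph) shuffles_weight_nonneg:
  assumes dist: "distinct [x1, x2, x3, y, z]" and clique: "is_clique G {x1, x2, x3, y, z}"
    and d: "d = (7 - sqrt 21) / 14"
    and deg: "(1 - d) * real (card (pverts G)) \<le> real (min_degree G)"
  shows "0 \<le> (\<Sum>vs\<in>shuffles [x1, x2, x3] [y, z]. W G (take 4 vs) * \<psi> vs [x1, x2, x3])"
proof -
  define k where "k S = real (card (common_nbrs G S))" for S
  define n where "n = real (card (pverts G))"
  define M where "M = real (card (pverts G) - min_degree G)"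
  have verts: "{x1, x2, x3, y, z} \<subseteq> pverts G" using clique by (simp add: is_clique_def)
  then have "0 < n" using pair_finite_verts by (auto simp: n_def card_gt_0_iff)
  have sqrt: "9 / 2 < sqrt 21" "sqrt 21 < 5"
    using real_less_rsqrt[of "9 / 2" 21] real_less_lsqrt[of 5 21] by (simp_all add: power2_eq_square)
  have dpos: "0 < d" and dlt: "d * 28 < 5" using sqrt by (auto simp: d)
  have deq: "1 - 7 * d + 7 * d^2 = 0" by (simp add: d power2_eq_square field_simps)
  have "0 \<le> M" by (simp add: M_def)
  have Mle: "M \<le> d * n"
  \<comment> \<open>Subtraction in \<open>M\<close> is truncated, so \<open>M = 0\<close> in the
    second case.\<close>
  proof (cases "min_degree G \<le> card (pverts G)")
    case True
    then show ?thesis using deg by (simp add: M_def n_def algebra_simps of_nat_diff)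
  next
    case False
    then show ?thesis using dpos by (simp add: M_def n_def)
  qed
  have "d * n * 28 < 5 * n" using dlt \<open>0 < n\<close> by (simp add: mult.commute mult.left_commute)
  \<comment> \<open>This makes all sizes positive: r vertices with r at most 4 have at least n - r *
    M common neighbours, and \<open>b + c - p\<close> is at least p - 2 * M.\<close>
  then have M4: "0 < n - 4 * M" using Mle \<open>0 < n\<close> by linarith
  have ins: "k S \<le> k (insert v S) + M" if "v \<in> {x1, x2, x3, y, z}" for v S
    using card_common_nbrs_le_insert[of v S] that verts unfolding k_def M_def by auto
  have mono: "k T \<le> k S" if "S \<subseteq> T" for S T
    using common_nbrs_antimono[OF that] by (simp add: k_def card_mono)
  have "k {} = n" by (simp add: k_def n_def common_nbrs_def)
  then have lower: "n - 2 * M \<le> k {x1, x2}" "n - 2 * M \<le> k {x1, y}" "n - 2 * M \<le> k {y, z}"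
    using ins[of _ "{}"] ins[of x1 "{x2}"] ins[of x1 "{y}"] ins[of y "{z}"] by force+
  have sub: "k {x1, x2, y} + k {x1, y, z} \<le> k {x1, x2, y, z} + k {x1, y}"
    using card_common_nbrs_supermodular[of x2 "{x1, y}" z]
    by (simp add: k_def insert_commute flip: of_nat_add)
  have steps:
    "k {x1, x2} \<le> k {x1, x2, x3} + M" "k {x1, x2, x3} \<le> k {x1, x2, x3, y} + M"
    "k {x1, x2} \<le> k {x1, x2, y} + M" "k {x1, y} \<le> k {x1, x2, y} + M"
    "k {x1, y} \<le> k {x1, y, z} + M" "k {y, z} \<le> k {x1, y, z} + M"
    using ins[of x3 "{x1, x2}"] ins[of y "{x1, x2, x3}"] ins[of y "{x1, x2}"] ins[of x2 "{x1, y}"]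
      ins[of z "{x1, y}"] ins[of x1 "{y, z}"]
    by (simp_all add: insert_commute)
  \<comment> \<open>For \<open>M = d * n\<close> and \<open>p = (1 - 2 * d) * n\<close> this reads
    \<open>0 \<le> 1 - 7 * d + 7 * d^2\<close>, an equality for the given \<open>d\<close>. Larger
    \<open>p\<close> only helps.\<close>
  have M: "3 * M^2 + 3 * M * k {x1, y} \<le> k {x1, y}^2"
  proof -
    define p where "p = k {x1, y}"
    have p: "(1 - 2 * d) * n \<le> p" using lower(2) Mle by (simp add: p_def algebra_simps)
    have nonneg: "0 \<le> (1 - 2 * d) * n" "0 \<le> (1 - 5 * d) * n"
      using dlt \<open>0 < n\<close> by (auto intro!: mult_nonneg_nonneg)
    have "0 \<le> p" using p nonneg(1) by linarith
    then have "3 * M^2 + 3 * M * p \<le> 3 * (d * n)^2 + 3 * (d * n) * p"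
      using Mle \<open>0 \<le> M\<close> by (intro add_mono mult_left_mono mult_right_mono power_mono) auto
    also have "3 * (d * n)^2 = ((1 - 2 * d) * n) * ((1 - 5 * d) * n)" using deq by algebra
    also have "\<dots> \<le> p * (p - 3 * (d * n))"
      using p nonneg \<open>0 \<le> p\<close> by (intro mult_mono) (auto simp: algebra_simps)
    finally show ?thesis by (simp add: p_def algebra_simps power2_eq_square)
  qed
  have "0 \<le> 1 / (k {x1, x2} * k {x1, x2, x3} * k {x1, x2, x3, y})
    + 1 / (k {x1, x2} * k {x1, x2, y} * k {x1, x2, x3, y})
    + 1 / (k {x1, x2} * k {x1, x2, y} * k {x1, x2, y, z})
    + 1 / (k {y, z} * k {x1, y, z} * k {x1, x2, y, z})
    - 1 / (k {x1, y} * k {x1, x2, y} * k {x1, x2, x3, y})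
    - 1 / (k {x1, y} * k {x1, x2, y} * k {x1, x2, y, z})
    - 1 / (k {x1, y} * k {x1, y, z} * k {x1, x2, y, z})"
  proof (rule interleaving_weights_nonneg[OF _ _ _ _ _ steps(3) _ steps(4) _ steps(5) _ steps(6) _ M \<open>0 \<le> M\<close>])
    show "k {x1, x2, x3} \<le> k {x1, x2}" "k {x1, x2, x3, y} \<le> k {x1, x2, y}"
      "k {x1, x2, y} \<le> k {x1, x2}" "k {x1, x2, y} \<le> k {x1, y}" "k {x1, y, z} \<le> k {x1, y}"
      by (auto intro!: mono)
    show "k {x1, x2, y} + k {x1, y, z} - k {x1, y} \<le> k {x1, x2, y, z}" using sub by simp
  qed (use steps lower M4 \<open>0 \<le> M\<close> in linarith)+
  then show ?thesis
    unfolding shuffles_weight_sum[OF dist clique] by (simp add: k_def)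
qed

theorem theorem3p14:
  fixes G :: "'a pair_pre_digraph" and d :: real and xs :: "'a list"
  assumes "pair_graph G"
    and "d = (7 - sqrt 21) / 14"
    and "real (min_degree G) \<ge> (1 - d) * real (card (pverts G))"
    and "xs \<in> ordered_cliques 3 G"
  shows "triangle_weight G xs \<ge> 0"
proof -
  interpret pair_graph G by fact
  let ?S = "ordered_5cliques_over G xs" and ?rest = "filter (\<lambda>v. v \<notin> set xs)"
  let ?g = "\<lambda>vs. W G (take 4 vs) * \<psi> vs xs"
  have "?S \<subseteq> {vs. set vs \<subseteq> pverts G \<and> length vs = 5}"
    by (auto simp: ordered_5cliques_over_def ordered_cliques_def is_clique_def)
  then have "finite ?S" using finite_lists_length_eq[OF pair_finite_verts] finite_subset by blast
  then have group: "sum ?g ?S = (\<Sum>ys\<in>?rest ` ?S. sum ?g {us \<in> ?S. ?rest us = ys})"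
    by (rule sum.image_gen)
  have "0 \<le> sum ?g ?S"
    unfolding group
  proof (rule sum_nonneg)
    fix ys assume "ys \<in> ?rest ` ?S"
    then obtain vs where vs: "vs \<in> ?S" and ys: "ys = ?rest vs" by auto
    have mem: "vs \<in> shuffles xs ys"
      using ordered_5cliques_over_fiber[OF vs] vs unfolding ys by blast
    have clique: "distinct vs" "length vs = 5" "is_clique G (set vs)"
      using vs by (auto simp: ordered_5cliques_over_def ordered_cliques_def)
    have "length xs = 3" "distinct xs" using assms(4) by (auto simp: ordered_cliques_def)
    moreover have "length ys = 2" using length_shuffles[OF mem] clique(2) \<open>length xs = 3\<close> by simp
    ultimately obtain x1 x2 x3 y z where eqs: "xs = [x1, x2, x3]" "ys = [y, z]"
      by (auto simp: numeral_eq_Suc length_Suc_conv)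
    have "set vs = {x1, x2, x3, y, z}" using set_shuffles[OF mem] by (auto simp: eqs)
    \<comment> \<open>The five names denote a set of size five.\<close>
    moreover from this have "distinct [x1, x2, x3, y, z]"
      using clique by (intro card_distinct) (simp flip: distinct_card)
    ultimately have "0 \<le> sum ?g (shuffles xs ys)"
      unfolding eqs using clique assms by (intro shuffles_weight_nonneg) auto
    then show "0 \<le> sum ?g {us \<in> ?S. ?rest us = ys}"
      unfolding ys ordered_5cliques_over_fiber[OF vs] .
  qed
  then show ?thesis by (simp add: triangle_weight_def)
qed

end
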